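(* Let $J$ be an infinite index set and let $1<p,q<\infty$ be such that $p^{-1}+q^{-1}=1$. The metric compactification $\overline{\ell_{p}(J)}^{h}=\overline{\ell_{p}(J)}^{h,F}\sqcup\overline{\ell_{p}(J)}^{h,\infty}$ of the infinite-dimensional space $\ell_p(J)$ is given by $$\overline{\ell_{p}(J)}^{h,F}=\left\{h^{\{z,c\}}\in\mathbb{R}^{\ell_{p}(J)}\;\middle|\; z\in\ell_{p}(J),\ c\geq\|z\|_{p}\right\}\cup\{0\},$$ $$\overline{\ell_{p}(J)}^{h,\infty}=\left\{h^{\{\mu\}}\in\mathbb{R}^{\ell_{p}(J)}\;\middle|\; \mu\in\ell_{q}(J),\ 0<\|\mu\|_{q}\leq 1\right\},$$ where for every $x\in\ell_p(J)$ $$h^{\{z,c\}}(x)=\left(\|x-z\|_{p}^{p}+c^{p}-\|z\|_{p}^{p}\right)^{1/p}-c,\qquad h^{\{\mu\}}(x)=-\sum_{j\in J}\mu(j)x(j).$$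
   Context: For $1\le r<\infty$, $\ell_r(J)$ is the real Banach space of all $x=(x(j))_{j\in J}\in\mathbb{R}^J$ with $\|x\|_r:=\left(\sum_{j\in J}|x(j)|^r\right)^{1/r}<\infty$, where the sum is the supremum over finite subsets of $J$ of the finite partial sums. $J$ may be countable or uncountable. Metric compactification: for a Banach space $(X,\|\cdot\|)$ and $y\in X$, let $h_y:X\to\mathbb{R}$, $h_y(x)=\|x-y\|-\|y\|$. The metric compactification $\overline{X}^{h}$ of $X$ is the closure of $\{h_y\mid y\in X\}$ in $\mathbb{R}^X$ with the product topology (the topology of pointwise convergence). It is partitioned as $\overline{X}^{h}=\overline{X}^{h,F}\sqcup\overline{X}^{h,\infty}$, where $\overline{X}^{h,F}:=\{h\in\overline{X}^{h}\mid \inf_{x\in X}h(x)>-\infty\}$ (finite metric functionals) and $\overline{X}^{h,\infty}:=\{h\in\overline{X}^{h}\mid \inf_{x\in X}h(x)=-\infty\}$ (metric functionals at infinity). Here $0$ denotes the identically zero function, and $c$ is a real number. *)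

theory Defs
  imports "HOL-Analysis.Analysis" "HOL-Library.Function_Algebras"
begin

section \<open>The metric compactification\<close>

text \<open>
  The normed space is given by its carrier \<open>X\<close> and its norm \<open>N\<close>; the exponent of
  \<open>\<ell>\<^sub>p(J)\<close> is a variable, so that space cannot be made into a type.  The product space of
  real-valued functions on \<open>X\<close> is the library's \<^term>\<open>powertop_real X\<close>, whose points are the
  functions that are undefined outside \<open>X\<close>.  This is why all functionals below are written
  with the restricted abstraction \<open>\<lambda>x\<in>X. \<dots>\<close>.
\<close>

definition internal_functional ::
    "('v::ab_group_add) set \<Rightarrow> ('v \<Rightarrow> real) \<Rightarrow> 'v \<Rightarrow> ('v \<Rightarrow> real)" where
  "internal_functional X N y = (\<lambda>x\<in>X. N (x - y) - N y)"

definition metric_compactification ::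
    "('v::ab_group_add) set \<Rightarrow> ('v \<Rightarrow> real) \<Rightarrow> ('v \<Rightarrow> real) set" where
  "metric_compactification X N =
     powertop_real X closure_of {internal_functional X N y | y. y \<in> X}"

text \<open>The infimum is taken in the extended reals, where it always exists.\<close>

definition finite_metric_functionals ::
    "('v::ab_group_add) set \<Rightarrow> ('v \<Rightarrow> real) \<Rightarrow> ('v \<Rightarrow> real) set" where
  "finite_metric_functionals X N =
     {h \<in> metric_compactification X N. (INF x\<in>X. ereal (h x)) > -\<infinity>}"

definition metric_functionals_at_infinity ::
    "('v::ab_group_add) set \<Rightarrow> ('v \<Rightarrow> real) \<Rightarrow> ('v \<Rightarrow> real) set" where
  "metric_functionals_at_infinity X N =
     {h \<in> metric_compactification X N. (INF x\<in>X. ereal (h x)) = -\<infinity>}"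


section \<open>The spaces of r-summable families\<close>

text \<open>
  A family indexed by the set \<open>J\<close> is a function on the ambient type that vanishes outside
  \<open>J\<close>, so that the pointwise vector operations of functions are those of the sequence space.
\<close>

definition lp_space :: "real \<Rightarrow> 'j set \<Rightarrow> ('j \<Rightarrow> real) set" where
  "lp_space r J = {x. (\<forall>j. j \<notin> J \<longrightarrow> x j = 0) \<and> (\<lambda>j. \<bar>x j\<bar> powr r) summable_on J}"

definition lp_norm :: "real \<Rightarrow> 'j set \<Rightarrow> ('j \<Rightarrow> real) \<Rightarrow> real" where
  "lp_norm r J x = (\<Sum>\<^sub>\<infinity>j\<in>J. \<bar>x j\<bar> powr r) powr (1 / r)"

text \<open>
  For these nonnegative terms, the library's unordered sum is the supremum of the
  partial sums over finite subsets.
\<close>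

lemma lp_space_iff_bdd_above:
  "x \<in> lp_space r J \<longleftrightarrow>
     (\<forall>j. j \<notin> J \<longrightarrow> x j = 0) \<and>
     bdd_above ((\<lambda>F. \<Sum>j\<in>F. \<bar>x j\<bar> powr r) ` {F. finite F \<and> F \<subseteq> J})"
  using abs_summable_iff_bdd_above[of "\<lambda>j. \<bar>x j\<bar> powr r" J]
  by (simp add: lp_space_def conj_commute)

lemma lp_norm_eq_SUP:
  assumes "x \<in> lp_space r J"
  shows "lp_norm r J x =
    (SUP F\<in>{F. finite F \<and> F \<subseteq> J}. \<Sum>j\<in>F. \<bar>x j\<bar> powr r) powr (1 / r)"
  using assms by (simp add: lp_space_def lp_norm_def infsum_nonneg_is_SUPREMUM_real)


section \<open>The functionals in the classification\<close>

definition h_zc :: "real \<Rightarrow> 'j set \<Rightarrow> ('j \<Rightarrow> real) \<Rightarrow> real \<Rightarrow> (('j \<Rightarrow> real) \<Rightarrow> real)" where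
  "h_zc p J z c = (\<lambda>x\<in>lp_space p J.
     (lp_norm p J (x - z) powr p + c powr p - lp_norm p J z powr p) powr (1 / p) - c)"

definition h_mu :: "real \<Rightarrow> 'j set \<Rightarrow> ('j \<Rightarrow> real) \<Rightarrow> (('j \<Rightarrow> real) \<Rightarrow> real)" where
  "h_mu p J \<mu> = (\<lambda>x\<in>lp_space p J. - (\<Sum>\<^sub>\<infinity>j\<in>J. \<mu> j * x j))"

end

theory Submission
  imports Defs
begin

text \<open>
  A point \<open>y\<close> of \<open>\<ell>\<^sub>p(J)\<close> is described by its radius \<open>t = \<parallel>y\<parallel>\<close> and a direction \<open>u\<close> with \<open>y = t u\<close>.
  Give the closed unit ball \<open>B\<close> the topology of coordinatewise convergence, in which it is compact
  (\<open>compact_lp_ball\<close>), and let the radius range over \<open>[0, \<infinity>]\<close>.  The functional of \<open>y\<close> is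
  \<open>(\<parallel>x - t u\<parallel>\<^sup>p + t\<^sup>p - \<parallel>t u\<parallel>\<^sup>p)\<^bsup>1/p\<^esup> - t\<close>, an expression that makes sense for every \<open>u\<close> in \<open>B\<close>: it is
  \<open>h_zc\<close> at \<open>z = t u\<close> and \<open>c = t\<close>.  The central point is that it extends to a continuous function of
  \<open>(u, t)\<close> on \<open>B \<times> [0, \<infinity>]\<close> with values in the space of functionals under pointwise convergence, the
  value at \<open>t = \<infinity>\<close> being \<open>h_mu\<close> at the image \<open>\<mu>\<close> of \<open>u\<close> under the duality map, \<open>\<mu> j = sgn (u j) \<bar>u j\<bar>\<^bsup>p-1\<^esup>\<close>.

  Continuity is proved in two charts, \<open>t \<in> [0, 1]\<close> and \<open>s = 1/t \<in> [0, 1]\<close>.  All the functionals are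
  nonexpansive in \<open>x\<close> (by Minkowski's inequality, and at infinity by Young's), so it suffices to treat
  finitely supported \<open>x\<close> (\<open>continuous_on_finite_support_limit\<close>).  For such \<open>x\<close> only finitely many
  coordinates of \<open>u\<close> occur, and the claim is one about real functions of finitely many variables.  In
  the second chart it is the differentiability of \<open>\<parallel>\<cdot>\<parallel>\<^sup>p\<close> in the direction \<open>x\<close>, with the uniformity in
  \<open>u\<close> supplied by the joint continuity of divided differences (\<open>continuous_on_h_polar_inverse\<close>).

  The image of the compact parameter space is then compact, hence closed, and contains every
  functional of a point, so it contains the metric compactification.  Since \<open>J\<close> is infinite the unit
  sphere is dense in \<open>B\<close> (\<open>lp_ball_subset_closure_sphere\<close>), so the functionals of points are dense in the
  image, and the two sets agree (\<open>metric_compactification_lp\<close>).  The duality map carries \<open>B\<close> onto the unit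
  ball of \<open>\<ell>\<^sub>q(J)\<close>, so the image consists of the \<open>h_zc\<close> with \<open>c \<ge> \<parallel>z\<parallel>\<close> and the \<open>h_mu\<close> with \<open>\<parallel>\<mu>\<parallel> \<le> 1\<close>;
  \<open>\<mu> = 0\<close> gives the zero functional.  Finally \<open>h_zc\<close> is bounded below by \<open>-c\<close>, whereas a nonzero
  linear functional is unbounded below.
\<close>

section \<open>Minkowski's inequality\<close>

text \<open>
  Convexity of the \<open>p\<close>-th power at \<open>(a + b)/(s + t)\<close>, the average of \<open>a/s\<close> and \<open>b/t\<close>
  with weights \<open>s/(s + t)\<close> and \<open>t/(s + t)\<close>.  Summing over an index set with \<open>s\<close> and \<open>t\<close> the norms of the
  two families turns the right-hand side into \<open>(s + t)\<^sup>p\<close>.  This gives Minkowski's inequality for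
  families and, in the same way, for pairs (\<open>root_shift_nonexpansive\<close>).
\<close>
lemma powr_add_le_weighted:
  fixes a b s t p :: real
  assumes "1 < p" "0 \<le> a" "0 \<le> b" "0 < s" "0 < t"
  shows "(a + b) powr p \<le> (s + t) powr (p - 1) * (a powr p / s powr (p - 1) + b powr p / t powr (p - 1))"
proof -
  have grow: "1 \<le> (s + t) powr (p - 1) / s powr (p - 1)" "1 \<le> (s + t) powr (p - 1) / t powr (p - 1)"
    using assms by (simp_all add: powr_mono2)
  consider "a = 0" | "b = 0" | "0 < a" "0 < b" using assms by linarith
  then show ?thesis
  proof cases
    case 1
    then show ?thesis
      using mult_left_mono[OF grow(2), of "b powr p"] by (simp add: field_simps)
  next
    case 2
    then show ?thesis
      using mult_left_mono[OF grow(1), of "a powr p"] by (simp add: field_simps)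
  next
    case 3
    define l where "l = s / (s + t)"
    have l: "0 \<le> l" "l \<le> 1" "1 - l = t / (s + t)"
      using assms by (simp_all add: l_def field_simps)
    have "((1 - l) * (b / t) + l * (a / s)) powr p \<le> (1 - l) * (b / t) powr p + l * (a / s) powr p"
      using convex_onD[OF powr_convex, of p l "b / t" "a / s"] assms 3 l by simp
    moreover have "(1 - l) * (b / t) + l * (a / s) = (a + b) / (s + t)"
      using assms unfolding l by (simp add: l_def add_divide_distrib)
    ultimately have "(a + b) powr p / (s + t) powr p
        \<le> t / (s + t) * (b powr p / t powr p) + s / (s + t) * (a powr p / s powr p)"
      using assms l by (simp add: powr_divide l_def)
    then have "(a + b) powr p \<le> (s + t) powr p * (t / (s + t) * (b powr p / t powr p) + s / (s + t) * (a powr p / s powr p))"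
      using assms by (simp add: field_simps)
    also have "\<dots> = (s + t) powr (p - 1) * (a powr p / s powr (p - 1) + b powr p / t powr (p - 1))"
    proof -
      have e: "c powr p = c powr (p - 1) * c" if "0 < c" for c
        using that by (simp add: powr_diff)
      have "A * S * (t / S * (b' / (T * t)) + s / S * (a' / (P * s))) = A * (a' / P + b' / T)"
        if "0 < S" "0 < T" "0 < P" for A S T P a' b'
        using that assms by (simp add: field_simps)
      then show ?thesis
        using assms by (simp only: e[of s] e[of t] e[of "s + t"] add_pos_pos powr_gt_zero)
    qed
    finally show ?thesis .
  qed
qed

lemma powr_inverse_le:
  fixes a b p :: real
  assumes "0 < p" "0 \<le> b" "a \<le> b powr p" "0 \<le> a"
  shows "a powr (1 / p) \<le> b"
  using powr_mono2[of "1 / p" a "b powr p"] assms by (simp add: powr_powr)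

lemma lp_norm_nonneg [simp]: "0 \<le> lp_norm r J x"
  by (simp add: lp_norm_def)

lemma lp_norm_powr:
  assumes "0 < r"
  shows "lp_norm r J x powr r = (\<Sum>\<^sub>\<infinity>j\<in>J. \<bar>x j\<bar> powr r)"
proof -
  have "0 \<le> (\<Sum>\<^sub>\<infinity>j\<in>J. \<bar>x j\<bar> powr r)" by (rule infsum_nonneg) simp
  then show ?thesis using assms by (simp add: lp_norm_def powr_powr)
qed

lemma lp_norm_le_iff:
  assumes "0 < r" "0 \<le> s"
  shows "lp_norm r J x \<le> s \<longleftrightarrow> (\<Sum>\<^sub>\<infinity>j\<in>J. \<bar>x j\<bar> powr r) \<le> s powr r"
  using assms unfolding lp_norm_powr[OF assms(1), symmetric]
  by (metis lp_norm_nonneg powr_less_mono2 powr_mono2 leD leI less_eq_real_def)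

lemma lp_norm_scale:
  assumes "0 < r"
  shows "lp_norm r J (\<lambda>j. c * x j) = \<bar>c\<bar> * lp_norm r J x"
proof -
  have "0 \<le> (\<Sum>\<^sub>\<infinity>j\<in>J. \<bar>x j\<bar> powr r)" by (rule infsum_nonneg) simp
  then show ?thesis
    using assms by (simp add: lp_norm_def abs_mult powr_mult infsum_cmult_right' powr_powr)
qed

lemma lp_space_scale: "x \<in> lp_space r J \<Longrightarrow> (\<lambda>j. c * x j) \<in> lp_space r J"
  by (auto simp: lp_space_def abs_mult powr_mult intro: summable_on_cmult_right)

lemma lp_norm_minus_commute: "lp_norm r J (x - y) = lp_norm r J (y - x)"
  by (simp add: lp_norm_def abs_minus_commute)

lemma lp_norm_eq_0D:
  assumes "0 < r" "x \<in> lp_space r J" "lp_norm r J x = 0"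
  shows "x = (\<lambda>_. 0)"
proof
  fix j
  have "(\<Sum>\<^sub>\<infinity>j\<in>J. \<bar>x j\<bar> powr r) = 0"
    using lp_norm_powr[OF assms(1), of J x] assms by simp
  then show "x j = 0"
    using nonneg_infsum_le_0D[of "\<lambda>j. \<bar>x j\<bar> powr r" J j] assms(2)
    by (cases "j \<in> J") (auto simp: lp_space_def)
qed

lemma finite_support_in_lp_space:
  assumes "finite F" "F \<subseteq> J" "\<And>j. j \<notin> F \<Longrightarrow> x j = 0"
  shows "x \<in> lp_space r J"
proof -
  have "(\<lambda>j. \<bar>x j\<bar> powr r) summable_on J \<longleftrightarrow> (\<lambda>j. \<bar>x j\<bar> powr r) summable_on F"
    by (rule summable_on_cong_neutral) (use assms in auto)
  then show ?thesis using assms by (auto simp: lp_space_def)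
qed

lemma infsum_finite_support:
  fixes f :: "'a \<Rightarrow> real"
  assumes "finite F" "F \<subseteq> J" "\<And>j. j \<in> J - F \<Longrightarrow> f j = 0"
  shows "infsum f J = sum f F"
  using infsum_cong_neutral[of F J f f] assms by auto

text \<open>Weighting by the two norms turns the scalar inequality into the triangle inequality; an
  \<open>\<epsilon>\<close> is added to each norm so that both weights are positive.\<close>
lemma
  assumes "1 < p" "x \<in> lp_space p J" "y \<in> lp_space p J"
  shows lp_space_add: "x + y \<in> lp_space p J"
    and lp_norm_triangle: "lp_norm p J (x + y) \<le> lp_norm p J x + lp_norm p J y"
proof -
  have sx: "(\<lambda>j. \<bar>x j\<bar> powr p) summable_on J" and sy: "(\<lambda>j. \<bar>y j\<bar> powr p) summable_on J"
    using assms by (auto simp: lp_space_def)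
  define g where "g s t j = (s + t) powr (p - 1) * (\<bar>x j\<bar> powr p / s powr (p - 1) + \<bar>y j\<bar> powr p / t powr (p - 1))" for s t j
  have le: "\<bar>(x + y) j\<bar> powr p \<le> g s t j" if "0 < s" "0 < t" for s t j
  proof -
    have "\<bar>(x + y) j\<bar> powr p \<le> (\<bar>x j\<bar> + \<bar>y j\<bar>) powr p"
      using assms by (intro powr_mono2) auto
    also have "\<dots> \<le> g s t j"
      unfolding g_def using assms that by (intro powr_add_le_weighted) auto
    finally show ?thesis .
  qed
  have sg: "g s t summable_on J" for s t
    unfolding g_def divide_inverse
    by (intro summable_on_cmult_right summable_on_add summable_on_cmult_left sx sy)
  have sxy: "(\<lambda>j. \<bar>(x + y) j\<bar> powr p) summable_on J"
    by (rule summable_on_comparison_test[OF sg[of 1 1]]) (use le in auto)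
  then show "x + y \<in> lp_space p J"
    using assms by (auto simp: lp_space_def)
  show "lp_norm p J (x + y) \<le> lp_norm p J x + lp_norm p J y"
  proof (rule field_le_epsilon)
    fix e :: real assume e: "0 < e"
    define s t where "s = lp_norm p J x + e / 2" and "t = lp_norm p J y + e / 2"
    have pos: "0 < s" "0 < t"
      using e lp_norm_nonneg[of p J x] lp_norm_nonneg[of p J y] unfolding s_def t_def by linarith+
    have x_mass: "(\<Sum>\<^sub>\<infinity>j\<in>J. \<bar>x j\<bar> powr p) \<le> s powr p" and y_mass: "(\<Sum>\<^sub>\<infinity>j\<in>J. \<bar>y j\<bar> powr p) \<le> t powr p"
      using assms e pos by (auto simp: lp_norm_powr[symmetric] s_def t_def intro!: powr_mono2)
    have "(\<Sum>\<^sub>\<infinity>j\<in>J. \<bar>(x + y) j\<bar> powr p) \<le> infsum (g s t) J"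
      using le pos by (intro infsum_mono sxy sg) auto
    also have "\<dots> = (s + t) powr (p - 1) *
        ((\<Sum>\<^sub>\<infinity>j\<in>J. \<bar>x j\<bar> powr p) / s powr (p - 1) + (\<Sum>\<^sub>\<infinity>j\<in>J. \<bar>y j\<bar> powr p) / t powr (p - 1))"
      unfolding g_def divide_inverse
      by (simp add: infsum_cmult_right' infsum_cmult_left' infsum_add summable_on_cmult_left sx sy)
    also have "\<dots> \<le> (s + t) powr (p - 1) * (s powr p / s powr (p - 1) + t powr p / t powr (p - 1))"
      using x_mass y_mass by (intro mult_left_mono add_mono divide_right_mono) auto
    also have "\<dots> = (s + t) powr p"
      using pos by (simp add: powr_diff)
    finally have "lp_norm p J (x + y) \<le> s + t"
      using assms pos by (subst lp_norm_le_iff) auto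
    then show "lp_norm p J (x + y) \<le> lp_norm p J x + lp_norm p J y + e"
      by (simp add: s_def t_def)
  qed
qed

lemma lp_space_diff:
  assumes "1 < p" "x \<in> lp_space p J" "y \<in> lp_space p J"
  shows "x - y \<in> lp_space p J"
proof -
  have "x + (\<lambda>j. (- 1) * y j) \<in> lp_space p J"
    by (intro lp_space_add lp_space_scale assms)
  moreover have "x + (\<lambda>j. (- 1) * y j) = x - y" by auto
  ultimately show ?thesis by simp
qed

lemma lp_norm_triangle_diff:
  assumes "1 < p" "x \<in> lp_space p J" "x' \<in> lp_space p J" "z \<in> lp_space p J"
  shows "lp_norm p J (x - z) \<le> lp_norm p J (x' - z) + lp_norm p J (x - x')"
  using lp_norm_triangle[OF assms(1) lp_space_diff[OF assms(1,3,4)] lp_space_diff[OF assms(1,2,3)]]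
  by simp

text \<open>
  Finitely supported families are dense, which reduces continuity statements about the functionals
  to finitely many coordinates.
\<close>
lemma truncation_tendsto:
  assumes "1 < p" "x \<in> lp_space p J"
  shows "((\<lambda>F. lp_norm p J (x - (\<lambda>j. if j \<in> F then x j else 0))) \<longlongrightarrow> 0) (finite_subsets_at_top J)"
proof -
  let ?m = "\<lambda>j. \<bar>x j\<bar> powr p"
  have s: "?m summable_on J" using assms by (simp add: lp_space_def)
  have "((\<lambda>F. infsum ?m J - sum ?m F) \<longlongrightarrow> infsum ?m J - infsum ?m J) (finite_subsets_at_top J)"
    by (intro tendsto_intros infsum_tendsto s)
  then have "((\<lambda>F. (infsum ?m J - sum ?m F) powr (1 / p)) \<longlongrightarrow> 0 powr (1 / p)) (finite_subsets_at_top J)"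
    using assms by (intro tendsto_powr2 tendsto_const)
      (auto simp: eventually_finite_subsets_at_top intro!: exI[of _ "{}"] finite_sum_le_infsum s)
  moreover have "\<forall>\<^sub>F F in finite_subsets_at_top J.
      (infsum ?m J - sum ?m F) powr (1 / p) = lp_norm p J (x - (\<lambda>j. if j \<in> F then x j else 0))"
    unfolding eventually_finite_subsets_at_top
  proof (intro exI[of _ "{}"] conjI allI impI)
    fix F assume F: "finite F \<and> {} \<subseteq> F \<and> F \<subseteq> J"
    have "infsum (\<lambda>j. \<bar>(x - (\<lambda>j. if j \<in> F then x j else 0)) j\<bar> powr p) J = infsum ?m (J - F)"
      by (rule infsum_cong_neutral) auto
    also have "\<dots> = infsum ?m J - sum ?m F"
      using F by (subst infsum_Diff) (auto simp: s)
    finally show "(infsum ?m J - sum ?m F) powr (1 / p) = lp_norm p J (x - (\<lambda>j. if j \<in> F then x j else 0))"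
      by (simp add: lp_norm_def)
  qed auto
  ultimately show ?thesis
    using assms by (simp add: tendsto_cong)
qed

section \<open>The two kinds of functionals\<close>

text \<open>
  Read \<open>(a\<^sup>p + d)\<^bsup>1/p\<^esup>\<close> as the \<open>\<ell>\<^sub>p\<close>-norm of a pair \<open>(a, d\<^bsup>1/p\<^esup>)\<close>: this is the triangle
  inequality for \<open>(b, d\<^bsup>1/p\<^esup>) + (e, 0)\<close>.  The weights are the norms \<open>m\<close> and \<open>e\<close> of the two pairs.
\<close>
lemma root_shift_nonexpansive:
  fixes a b d p :: real
  assumes "1 < p" "0 \<le> a" "0 \<le> b" "0 \<le> d" "a \<le> b + e" "0 \<le> e"
  shows "(a powr p + d) powr (1 / p) \<le> (b powr p + d) powr (1 / p) + e"
proof -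
  define m where "m = (b powr p + d) powr (1 / p)"
  have m: "0 \<le> m" "m powr p = b powr p + d"
    using assms by (simp_all add: m_def powr_powr)
  have "a powr p + d \<le> (b + e) powr p + d"
    using assms by (simp add: powr_mono2)
  also have "\<dots> \<le> (m + e) powr p"
  proof (cases "m = 0 \<or> e = 0")
    case True
    then show ?thesis
      using m assms by (auto simp: add_nonneg_eq_0_iff)
  next
    case False
    then have pos: "0 < m" "0 < e" using m assms by auto
    have "(m + e) powr (p - 1) \<ge> m powr (p - 1)"
      using pos assms by (intro powr_mono2) auto
    then have "d \<le> (m + e) powr (p - 1) * (d / m powr (p - 1))"
      using mult_left_mono[of "m powr (p - 1)" "(m + e) powr (p - 1)" d] pos assms
      by (simp add: field_simps)
    moreover have "(b + e) powr p \<le> (m + e) powr (p - 1) * (b powr p / m powr (p - 1) + e powr p / e powr (p - 1))"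
      using assms pos by (intro powr_add_le_weighted) auto
    ultimately have "(b + e) powr p + d \<le> (m + e) powr (p - 1) * ((b powr p + d) / m powr (p - 1) + e powr p / e powr (p - 1))"
      by (simp add: algebra_simps add_divide_distrib)
    also have "\<dots> = (m + e) powr p"
      using pos unfolding m(2)[symmetric] by (simp add: powr_diff)
    finally show ?thesis .
  qed
  finally show ?thesis
    unfolding m_def[symmetric] using assms m by (intro powr_inverse_le) auto
qed

lemma h_zc_one_sided:
  assumes p: "1 < p" and mem: "x \<in> lp_space p J" "x' \<in> lp_space p J" "z \<in> lp_space p J"
    and c: "lp_norm p J z \<le> c"
  shows "h_zc p J z c x \<le> h_zc p J z c x' + lp_norm p J (x - x')"
proof -
  have "0 \<le> c powr p - lp_norm p J z powr p"
    using c p by (simp add: powr_mono2)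
  from root_shift_nonexpansive[OF p lp_norm_nonneg lp_norm_nonneg this
      lp_norm_triangle_diff[OF p mem] lp_norm_nonneg]
  show ?thesis using mem by (simp add: h_zc_def add_diff_eq)
qed

lemma h_zc_nonexpansive:
  assumes "1 < p" "x \<in> lp_space p J" "x' \<in> lp_space p J" "z \<in> lp_space p J" "lp_norm p J z \<le> c"
  shows "\<bar>h_zc p J z c x - h_zc p J z c x'\<bar> \<le> lp_norm p J (x - x')"
  using h_zc_one_sided[of p x J x' z c] h_zc_one_sided[of p x' J x z c] assms
  by (simp add: lp_norm_minus_commute[of p J x' x] abs_le_iff)

text \<open>
  For finitely supported \<open>x\<close> the families \<open>x - z\<close> and \<open>z\<close> differ at finitely many places, so the
  functional sees only finitely many coordinates of \<open>z\<close>; this is why coordinatewise convergence of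
  \<open>z\<close> together with convergence of \<open>c\<close> controls it.
\<close>
lemma h_zc_finite_support:
  assumes p: "1 < p" and z: "z \<in> lp_space p J" and F: "finite F" "F \<subseteq> J"
    and x: "\<And>j. j \<notin> F \<Longrightarrow> x j = 0"
  shows "h_zc p J z c x = ((\<Sum>j\<in>F. \<bar>x j - z j\<bar> powr p - \<bar>z j\<bar> powr p) + c powr p) powr (1 / p) - c"
proof -
  have xm: "x \<in> lp_space p J"
    by (rule finite_support_in_lp_space) (use F x in auto)
  have "lp_norm p J (x - z) powr p - lp_norm p J z powr p
      = (\<Sum>\<^sub>\<infinity>j\<in>J. \<bar>(x - z) j\<bar> powr p + - (\<bar>z j\<bar> powr p))"
    using p z lp_space_diff[OF p xm z]
    by (subst infsum_add) (auto simp: lp_norm_powr infsum_uminus lp_space_def summable_on_uminus)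
  also have "\<dots> = (\<Sum>j\<in>F. \<bar>(x - z) j\<bar> powr p + - (\<bar>z j\<bar> powr p))"
    using F x by (intro infsum_finite_support) auto
  finally show ?thesis
    using xm by (simp add: h_zc_def algebra_simps)
qed

lemma h_zc_lp_norm_eq_internal:
  assumes "0 < p"
  shows "h_zc p J z (lp_norm p J z) = internal_functional (lp_space p J) (lp_norm p J) z"
  using assms by (auto simp: h_zc_def internal_functional_def powr_powr)

text \<open>
  Young's inequality, summed over \<open>J\<close>, bounds the pairing by \<open>1/p + 1/q = 1\<close> when \<open>x\<close> is scaled to norm
  \<open>1\<close>.
\<close>
lemma
  assumes p: "1 < p" "1 < q" "1 / p + 1 / q = 1"
    and m: "\<mu> \<in> lp_space q J" "lp_norm q J \<mu> \<le> 1" and x: "x \<in> lp_space p J"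
  shows conjugate_mult_summable: "(\<lambda>j. \<mu> j * x j) summable_on J"
    and conjugate_mult_bound: "\<bar>\<Sum>\<^sub>\<infinity>j\<in>J. \<mu> j * x j\<bar> \<le> lp_norm p J x"
proof -
  have sm: "(\<lambda>j. \<bar>\<mu> j\<bar> powr q) summable_on J" using m by (simp add: lp_space_def)
  have mle: "(\<Sum>\<^sub>\<infinity>j\<in>J. \<bar>\<mu> j\<bar> powr q) \<le> 1"
    using m p lp_norm_le_iff[of q 1 J \<mu>] by simp
  have young: "(\<lambda>j. \<bar>\<mu> j * y j\<bar>) summable_on J"
      "(\<Sum>\<^sub>\<infinity>j\<in>J. \<bar>\<mu> j * y j\<bar>) \<le> (\<Sum>\<^sub>\<infinity>j\<in>J. \<bar>y j\<bar> powr p) / p + 1 / q"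
    if y: "y \<in> lp_space p J" for y
  proof -
    have sy: "(\<lambda>j. \<bar>y j\<bar> powr p) summable_on J" using y by (simp add: lp_space_def)
    have le: "\<bar>\<mu> j * y j\<bar> \<le> \<bar>y j\<bar> powr p / p + \<bar>\<mu> j\<bar> powr q / q" for j
      using Youngs_inequality[OF p, of "\<bar>y j\<bar>" "\<bar>\<mu> j\<bar>"] by (simp add: abs_mult mult.commute)
    have sg: "(\<lambda>j. \<bar>y j\<bar> powr p / p + \<bar>\<mu> j\<bar> powr q / q) summable_on J"
      unfolding divide_inverse by (intro summable_on_add summable_on_cmult_left sy sm)
    show s: "(\<lambda>j. \<bar>\<mu> j * y j\<bar>) summable_on J"
      by (rule summable_on_comparison_test[OF sg]) (use le in auto)
    have "(\<Sum>\<^sub>\<infinity>j\<in>J. \<bar>\<mu> j * y j\<bar>) \<le> (\<Sum>\<^sub>\<infinity>j\<in>J. \<bar>y j\<bar> powr p / p + \<bar>\<mu> j\<bar> powr q / q)"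
      by (intro infsum_mono s sg le)
    also have "\<dots> = (\<Sum>\<^sub>\<infinity>j\<in>J. \<bar>y j\<bar> powr p) / p + (\<Sum>\<^sub>\<infinity>j\<in>J. \<bar>\<mu> j\<bar> powr q) / q"
      unfolding divide_inverse
      by (simp add: infsum_add infsum_cmult_left' summable_on_cmult_left sy sm)
    also have "\<dots> \<le> (\<Sum>\<^sub>\<infinity>j\<in>J. \<bar>y j\<bar> powr p) / p + 1 / q"
      using mle p by (simp add: divide_right_mono)
    finally show "(\<Sum>\<^sub>\<infinity>j\<in>J. \<bar>\<mu> j * y j\<bar>) \<le> (\<Sum>\<^sub>\<infinity>j\<in>J. \<bar>y j\<bar> powr p) / p + 1 / q" .
  qed
  show "(\<lambda>j. \<mu> j * x j) summable_on J"
    by (rule abs_summable_summable) (use young(1)[OF x] in simp)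
  show "\<bar>\<Sum>\<^sub>\<infinity>j\<in>J. \<mu> j * x j\<bar> \<le> lp_norm p J x"
  proof (cases "lp_norm p J x = 0")
    case True
    then show ?thesis using lp_norm_eq_0D[of p x J] x p by simp
  next
    case False
    then have pos: "0 < lp_norm p J x" by (simp add: less_le)
    define y where "y = (\<lambda>j. (1 / lp_norm p J x) * x j)"
    have y: "y \<in> lp_space p J" unfolding y_def by (rule lp_space_scale[OF x])
    have "lp_norm p J y = 1"
      unfolding y_def using p pos by (subst lp_norm_scale) auto
    then have "(\<Sum>\<^sub>\<infinity>j\<in>J. \<bar>y j\<bar> powr p) = 1"
      using lp_norm_powr[of p J y] p by simp
    then have "(\<Sum>\<^sub>\<infinity>j\<in>J. \<bar>\<mu> j * y j\<bar>) \<le> 1"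
      using young(2)[OF y] p by simp
    moreover have "(\<Sum>\<^sub>\<infinity>j\<in>J. \<bar>\<mu> j * y j\<bar>) = (1 / lp_norm p J x) * (\<Sum>\<^sub>\<infinity>j\<in>J. \<bar>\<mu> j * x j\<bar>)"
      unfolding infsum_cmult_right'[symmetric] using pos
      by (intro infsum_cong) (auto simp: y_def abs_mult)
    ultimately have "(\<Sum>\<^sub>\<infinity>j\<in>J. \<bar>\<mu> j * x j\<bar>) \<le> lp_norm p J x"
      using pos by (simp add: field_simps)
    then show ?thesis
      using norm_infsum_bound[of "\<lambda>j. \<mu> j * x j" J] young(1)[OF x] by simp
  qed
qed

lemma h_mu_nonexpansive:
  assumes p: "1 < p" "1 < q" "1 / p + 1 / q = 1"
    and m: "\<mu> \<in> lp_space q J" "lp_norm q J \<mu> \<le> 1"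
    and x: "x \<in> lp_space p J" "x' \<in> lp_space p J"
  shows "\<bar>h_mu p J \<mu> x - h_mu p J \<mu> x'\<bar> \<le> lp_norm p J (x - x')"
proof -
  have s: "(\<lambda>j. \<mu> j * y j) summable_on J" if "y \<in> lp_space p J" for y
    by (rule conjugate_mult_summable[OF p m that])
  have "(\<Sum>\<^sub>\<infinity>j\<in>J. \<mu> j * x j) + - (\<Sum>\<^sub>\<infinity>j\<in>J. \<mu> j * x' j) = (\<Sum>\<^sub>\<infinity>j\<in>J. \<mu> j * (x - x') j)"
    unfolding infsum_uminus[symmetric]
    using s[OF x(1)] s[OF x(2)]
    by (subst infsum_add[symmetric]) (auto simp: algebra_simps summable_on_uminus)
  then show ?thesis
    using conjugate_mult_bound[OF p m lp_space_diff[OF p(1) x]] x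
    by (simp add: h_mu_def abs_minus_commute)
qed

section \<open>Difference quotients\<close>

lemma has_real_derivative_abs_powr:
  fixes p x :: real
  assumes "1 < p"
  shows "((\<lambda>x. \<bar>x\<bar> powr p) has_real_derivative p * (sgn x * \<bar>x\<bar> powr (p - 1))) (at x)"
proof -
  consider "0 < x" | "x < 0" | "x = 0" by linarith
  then show ?thesis
  proof cases
    case 1
    have "((\<lambda>x. x powr p) has_real_derivative p * x powr (p - 1)) (at x)"
      using 1 by (rule has_real_derivative_powr)
    then have "((\<lambda>x. \<bar>x\<bar> powr p) has_real_derivative p * x powr (p - 1)) (at x)"
      by (rule has_field_derivative_transform_within_open[where S = "{0<..}"]) (use 1 in auto)
    then show ?thesis using 1 by simp
  next
    case 2
    have "((\<lambda>x. (- x) powr p) has_real_derivative - (p * (- x) powr (p - 1))) (at x)"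
      using DERIV_chain2[OF has_real_derivative_powr[of "- x" p] DERIV_minus[OF DERIV_ident]] 2 by simp
    then have "((\<lambda>x. \<bar>x\<bar> powr p) has_real_derivative - (p * (- x) powr (p - 1))) (at x)"
      by (rule has_field_derivative_transform_within_open[where S = "{..<0}"]) (use 2 in auto)
    then show ?thesis using 2 by simp
  next
    case 3
    have "((\<lambda>h. \<bar>h\<bar> powr (p - 1)) \<longlongrightarrow> \<bar>0\<bar> powr (p - 1)) (at (0::real))"
      by (rule tendsto_powr2[OF tendsto_rabs[OF tendsto_ident_at] tendsto_const]) (use assms in simp_all)
    moreover have "\<bar>\<bar>h\<bar> powr p / h\<bar> = \<bar>h\<bar> powr (p - 1)" for h
      by (cases "h = 0") (simp_all add: powr_diff)
    ultimately have "((\<lambda>h. \<bar>\<bar>h\<bar> powr p / h\<bar>) \<longlongrightarrow> 0) (at 0)"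
      by (simp only: abs_zero powr_0)
    then have "((\<lambda>h. \<bar>h\<bar> powr p / h) \<longlongrightarrow> 0) (at 0)"
      by (rule tendsto_rabs_zero_cancel)
    then show ?thesis using 3 by (simp add: has_field_derivative_iff)
  qed
qed

lemma continuous_on_signed_powr:
  fixes r :: real
  assumes "0 < r"
  shows "continuous_on UNIV (\<lambda>x::real. sgn x * \<bar>x\<bar> powr r)"
proof -
  have "sgn x * \<bar>x\<bar> powr r = max x 0 powr r - max (- x) 0 powr r" for x :: real
    by (cases x "0::real" rule: linorder_cases) simp_all
  moreover have "continuous_on UNIV (\<lambda>x::real. max x 0 powr r - max (- x) 0 powr r)"
    using assms
    by (intro continuous_on_diff continuous_on_powr'[OF continuous_on_max[OF _ continuous_on_const] continuous_on_const]
        continuous_on_minus continuous_on_id) simp_all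
  ultimately show ?thesis by simp
qed

lemma continuous_on_abs_powr:
  fixes f :: "'a::topological_space \<Rightarrow> real"
  assumes "continuous_on S f" "0 < r"
  shows "continuous_on S (\<lambda>w. \<bar>f w\<bar> powr r)"
  by (rule continuous_on_powr'[OF continuous_on_rabs[OF assms(1)] continuous_on_const]) (simp add: assms(2))

definition divided_difference :: "(real \<Rightarrow> real) \<Rightarrow> (real \<Rightarrow> real) \<Rightarrow> real \<Rightarrow> real \<Rightarrow> real" where
  "divided_difference f f' a b = (if a = b then f' a else (f a - f b) / (a - b))"

lemma divided_difference_mult:
  "divided_difference f f' a b * (a - b) = f a - f b"
  by (simp add: divided_difference_def)

text \<open>
  Near the diagonal the mean value theorem replaces the quotient by a nearby value of \<open>f'\<close>.
  Continuity in both variables together is what allows \<open>u\<close> to vary while the scale tends to \<open>0\<close>.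
\<close>
lemma continuous_on_divided_difference:
  fixes f f' :: "real \<Rightarrow> real"
  assumes f: "\<And>x. (f has_real_derivative f' x) (at x)" and f': "continuous_on UNIV f'"
  shows "continuous_on UNIV (\<lambda>w. divided_difference f f' (fst w) (snd w))"
proof (intro continuous_at_imp_continuous_on ballI)
  fix w :: "real \<times> real"
  obtain a b where w: "w = (a, b)" by (cases w)
  have fc: "continuous_on UNIV f"
    using f DERIV_isCont by (intro continuous_at_imp_continuous_on) blast
  show "isCont (\<lambda>w. divided_difference f f' (fst w) (snd w)) w"
  proof (cases "a = b")
    case False
    have "open {w :: real \<times> real. fst w \<noteq> snd w}"
      by (intro open_Collect_neq continuous_intros)
    then have "\<forall>\<^sub>F w in nhds w. fst w \<noteq> snd w"
      using False w eventually_nhds_in_open[of "{w :: real \<times> real. fst w \<noteq> snd w}" w] by simp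
    then have "\<forall>\<^sub>F w in nhds w. divided_difference f f' (fst w) (snd w) = (f (fst w) - f (snd w)) / (fst w - snd w)"
      by eventually_elim (simp add: divided_difference_def)
    moreover have "isCont (\<lambda>w. (f (fst w) - f (snd w)) / (fst w - snd w)) w"
    proof -
      have "continuous_on UNIV (\<lambda>w :: real \<times> real. f (fst w))" "continuous_on UNIV (\<lambda>w :: real \<times> real. f (snd w))"
        by (auto intro!: continuous_on_compose2[OF fc] continuous_on_fst continuous_on_snd continuous_on_id)
      then have "isCont (\<lambda>w. f (fst w)) w" "isCont (\<lambda>w. f (snd w)) w"
        by (simp_all add: w continuous_on_eq_continuous_at)
      moreover have "fst w - snd w \<noteq> 0" using False w by simp
      ultimately show ?thesis
        by (intro isCont_divide isCont_diff isCont_fst isCont_snd continuous_ident)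
    qed
    ultimately show ?thesis by (rule isCont_cong[THEN iffD2])
  next
    case True
    show ?thesis unfolding continuous_at_eps_delta
    proof (intro allI impI)
      fix e :: real assume "0 < e"
      then obtain d where d: "0 < d" "\<And>x. \<bar>x - a\<bar> < d \<Longrightarrow> \<bar>f' x - f' a\<bar> < e"
        using f' unfolding continuous_on_eq_continuous_at[OF open_UNIV] continuous_at_eps_delta dist_real_def
        by (meson UNIV_I)
      have "\<bar>divided_difference f f' a' b' - f' a\<bar> < e" if ab: "\<bar>a' - a\<bar> < d" "\<bar>b' - a\<bar> < d" for a' b'
      proof -
        have key: "\<exists>z. \<bar>z - a\<bar> < d \<and> f y - f x = (y - x) * f' z"
          if xy: "x < y" "\<bar>x - a\<bar> < d" "\<bar>y - a\<bar> < d" for x y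
        proof -
          obtain z where "x < z" "z < y" "f y - f x = (y - x) * f' z"
            using MVT2[OF xy(1), of f f'] f by blast
          then show ?thesis using xy by (intro exI[of _ z]) auto
        qed
        consider "a' = b'" | "a' < b'" | "b' < a'" by linarith
        then have "\<exists>z. \<bar>z - a\<bar> < d \<and> divided_difference f f' a' b' = f' z"
        proof cases
          case 1
          then show ?thesis using ab by (auto simp: divided_difference_def)
        next
          case 2
          then obtain z where z: "\<bar>z - a\<bar> < d" "f b' - f a' = (b' - a') * f' z"
            using key[of a' b'] ab by blast
          then have "f a' - f b' = f' z * (a' - b')" by (simp add: algebra_simps)
          then have "divided_difference f f' a' b' = f' z"
            using 2 by (simp add: divided_difference_def)
          with z show ?thesis by blast
        next
          case 3
          then obtain z where z: "\<bar>z - a\<bar> < d" "f a' - f b' = (a' - b') * f' z"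
            using key[of b' a'] ab by blast
          then have "f a' - f b' = f' z * (a' - b')" by (simp add: algebra_simps)
          then have "divided_difference f f' a' b' = f' z"
            using 3 by (simp add: divided_difference_def)
          with z show ?thesis by blast
        qed
        then show ?thesis using d by auto
      qed
      moreover have "\<bar>fst w' - a\<bar> < d" "\<bar>snd w' - a\<bar> < d" if "dist w' w < d" for w'
        using that dist_fst_le[of w' w] dist_snd_le[of w' w] w True by (simp_all add: dist_real_def)
      moreover have "divided_difference f f' (fst w) (snd w) = f' a"
        using w True by (simp add: divided_difference_def)
      ultimately show "\<exists>d>0. \<forall>w'. dist w' w < d \<longrightarrow>
          dist (divided_difference f f' (fst w') (snd w')) (divided_difference f f' (fst w) (snd w)) < e"
        using d(1) unfolding dist_real_def by metis
    qed
  qed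
qed

text \<open>
  The factor \<open>g\<close> is the divided difference of \<open>y\<^bsup>1/p\<^esup>\<close> at \<open>y\<close> and \<open>1\<close>.  It is continuous up to
  \<open>y = 0\<close>, where the root may fail to be differentiable, since only the point \<open>y = 1\<close> needs a derivative.
\<close>
lemma root_difference_quotient:
  fixes p :: real
  assumes "0 < p"
  obtains g where "\<And>y. y powr (1 / p) - 1 = g y * (y - 1)" "g 1 = 1 / p" "continuous_on {0..} g"
proof -
  have "((\<lambda>y. y powr (1 / p)) has_real_derivative 1 / p) (at 1)"
    using has_real_derivative_powr[of 1 "1 / p"] by simp
  then obtain g where g: "\<And>y. y powr (1 / p) - 1 = g y * (y - 1)" "isCont g 1" "g 1 = 1 / p"
    unfolding CARAT_DERIV by auto
  have quot: "g y = (y powr (1 / p) - 1) / (y - 1)" if "y \<noteq> 1" for y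
    using g(1)[of y] that by simp
  have "continuous_on ({0..} - {1}) (\<lambda>y. (y powr (1 / p) - 1) / (y - 1))"
    by (intro continuous_on_divide continuous_on_diff continuous_on_powr' continuous_on_id continuous_on_const)
      (use assms in auto)
  then have c: "continuous_on ({0..} - {1}) g"
    by (rule continuous_on_eq) (use quot in auto)
  have "continuous_on {0..} g"
    unfolding continuous_on_eq_continuous_within
  proof
    fix y :: real assume y: "y \<in> {0..}"
    show "continuous (at y within {0..}) g"
    proof (cases "y = 1")
      case True
      then show ?thesis using g(2) continuous_at_imp_continuous_at_within by blast
    next
      case False
      then have "continuous (at y within {0..} - {1}) g"
        using c y by (simp add: continuous_on_eq_continuous_within)
      moreover have "at y within ({0..} - {1}) = at y within {0..}"
        using at_within_nhd[of y "- {1}" "{0..} - {1}" "{0..}"] False by auto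
      ultimately show ?thesis by simp
    qed
  qed
  with g that show thesis by blast
qed

section \<open>Two charts for the functionals\<close>

definition lp_ball :: "real \<Rightarrow> 'j set \<Rightarrow> ('j \<Rightarrow> real) set" where
  "lp_ball p J = {u \<in> lp_space p J. lp_norm p J u \<le> 1}"

lemma lp_ball_sum_le:
  assumes p: "0 < p" and u: "u \<in> lp_ball p J" and F: "finite F" "F \<subseteq> J"
  shows "(\<Sum>j\<in>F. \<bar>u j\<bar> powr p) \<le> 1"
proof -
  have "(\<Sum>j\<in>F. \<bar>u j\<bar> powr p) \<le> (\<Sum>\<^sub>\<infinity>j\<in>J. \<bar>u j\<bar> powr p)"
    using u F by (intro finite_sum_le_infsum) (auto simp: lp_ball_def lp_space_def)
  also have "\<dots> \<le> 1"
    using u p lp_norm_le_iff[of p 1 J u] by (simp add: lp_ball_def)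
  finally show ?thesis .
qed

text \<open>
  Polar coordinates for the point \<open>z = t u\<close>, with the radius \<open>t\<close> kept as the constant \<open>c\<close>.  The
  direction \<open>u\<close> ranges over the ball, not the sphere, because mass of the points \<open>y\<close> can escape
  in a coordinatewise limit; the deficit \<open>1 - \<parallel>u\<parallel>\<^sup>p\<close> is the escaped fraction of \<open>t\<^sup>p\<close>.
\<close>
definition h_polar :: "real \<Rightarrow> 'j set \<Rightarrow> ('j \<Rightarrow> real) \<Rightarrow> real \<Rightarrow> ('j \<Rightarrow> real) \<Rightarrow> real" where
  "h_polar p J u t = h_zc p J (\<lambda>j. t * u j) t"

text \<open>
  The gradient of \<open>u \<mapsto> \<parallel>u\<parallel>\<^sup>p / p\<close>.
\<close>
definition duality_map :: "real \<Rightarrow> ('j \<Rightarrow> real) \<Rightarrow> 'j \<Rightarrow> real" where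
  "duality_map p u = (\<lambda>j. sgn (u j) * \<bar>u j\<bar> powr (p - 1))"

text \<open>
  The same family in terms of the inverse radius \<open>s = 1/t\<close>, completed at \<open>s = 0\<close> by the limit
  \<open>t \<rightarrow> \<infinity>\<close>.
\<close>
definition h_polar_inverse :: "real \<Rightarrow> 'j set \<Rightarrow> ('j \<Rightarrow> real) \<Rightarrow> real \<Rightarrow> ('j \<Rightarrow> real) \<Rightarrow> real" where
  "h_polar_inverse p J u s = (if s = 0 then h_mu p J (duality_map p u) else h_polar p J u (1 / s))"

lemma conjugate_exponent:
  fixes p q :: real
  assumes "1 < p" "1 < q" "1 / p + 1 / q = 1"
  shows "(p - 1) * q = p" "(q - 1) * (p - 1) = 1"
proof -
  have "p * q * (1 / p + 1 / q) = p * q"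
    using assms(3) by simp
  then have "q + p = p * q"
    using assms(1,2) by (simp add: distrib_left)
  then show "(p - 1) * q = p" "(q - 1) * (p - 1) = 1"
    by (simp_all add: left_diff_distrib right_diff_distrib mult.commute)
qed

lemma
  assumes p: "1 < p" "1 < q" "1 / p + 1 / q = 1" and u: "u \<in> lp_space p J"
  shows duality_map_in_lp_space: "duality_map p u \<in> lp_space q J"
    and lp_norm_duality_map: "lp_norm q J (duality_map p u) powr q = lp_norm p J u powr p"
proof -
  have eq: "\<bar>duality_map p u j\<bar> powr q = \<bar>u j\<bar> powr p" for j
    using conjugate_exponent[OF p] p by (simp add: duality_map_def abs_mult powr_powr abs_sgn_eq)
  show "duality_map p u \<in> lp_space q J"
    using u eq by (auto simp: lp_space_def duality_map_def)
  show "lp_norm q J (duality_map p u) powr q = lp_norm p J u powr p"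
    using p by (simp add: lp_norm_powr eq)
qed

lemma duality_map_inverse:
  assumes p: "1 < p" "1 < q" "1 / p + 1 / q = 1"
  shows "duality_map p (duality_map q \<mu>) = \<mu>"
proof
  fix j
  show "duality_map p (duality_map q \<mu>) j = \<mu> j"
    using conjugate_exponent[OF p] p
    by (cases "\<mu> j = 0") (simp_all add: duality_map_def abs_mult powr_powr sgn_mult abs_sgn_eq sgn_mult_abs)
qed

lemma duality_map_ball:
  assumes p: "1 < p" "1 < q" "1 / p + 1 / q = 1" and u: "u \<in> lp_ball p J"
  shows "duality_map p u \<in> lp_ball q J"
proof -
  have "lp_norm q J (duality_map p u) powr q \<le> 1 powr p"
    unfolding lp_norm_duality_map[OF p, of u J, OF u[unfolded lp_ball_def, simplified, THEN conjunct1]]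
    using u p by (intro powr_mono2) (auto simp: lp_ball_def)
  then have "lp_norm q J (duality_map p u) \<le> 1"
    using p by (subst lp_norm_le_iff) (auto simp: lp_norm_powr)
  then show ?thesis
    using u duality_map_in_lp_space[OF p, of u J] by (simp add: lp_ball_def)
qed

lemma scale_lp_ball:
  assumes "0 < p" "u \<in> lp_ball p J" "0 \<le> t"
  shows "(\<lambda>j. t * u j) \<in> lp_space p J" "lp_norm p J (\<lambda>j. t * u j) \<le> t"
  using assms mult_left_mono[of "lp_norm p J u" 1 t]
  by (auto simp: lp_ball_def lp_space_scale lp_norm_scale)

lemma h_polar_nonexpansive:
  assumes "1 < p" "u \<in> lp_ball p J" "0 \<le> t" "x \<in> lp_space p J" "x' \<in> lp_space p J"
  shows "\<bar>h_polar p J u t x - h_polar p J u t x'\<bar> \<le> lp_norm p J (x - x')"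
  unfolding h_polar_def using assms by (intro h_zc_nonexpansive scale_lp_ball) auto

lemma h_polar_inverse_nonexpansive:
  assumes p: "1 < p" "1 < q" "1 / p + 1 / q = 1"
    and "u \<in> lp_ball p J" "0 \<le> s" "x \<in> lp_space p J" "x' \<in> lp_space p J"
  shows "\<bar>h_polar_inverse p J u s x - h_polar_inverse p J u s x'\<bar> \<le> lp_norm p J (x - x')"
proof (cases "s = 0")
  case True
  moreover have "duality_map p u \<in> lp_space q J" "lp_norm q J (duality_map p u) \<le> 1"
    using duality_map_ball[OF p assms(4)] by (simp_all add: lp_ball_def)
  ultimately show ?thesis
    using h_mu_nonexpansive[OF p _ _ assms(6,7)] by (simp add: h_polar_inverse_def)
next
  case False
  then show ?thesis
    using h_polar_nonexpansive[OF p(1) assms(4) _ assms(6,7), of "1 / s"] assms(5)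
    by (simp add: h_polar_inverse_def)
qed

text \<open>
  Because \<open>f w\<close> is nonexpansive for each \<open>w\<close>, replacing \<open>x\<close> by a truncation changes \<open>f w x\<close> by
  less than \<open>\<epsilon>\<close> for all \<open>w\<close> at once, so \<open>w \<mapsto> f w x\<close> is a uniform limit of continuous functions.
\<close>
lemma continuous_on_finite_support_limit:
  fixes f :: "'a::topological_space \<Rightarrow> ('j \<Rightarrow> real) \<Rightarrow> real"
  assumes p: "1 < p" and x: "x \<in> lp_space p J"
    and nonexp: "\<And>w y y'. w \<in> K \<Longrightarrow> y \<in> lp_space p J \<Longrightarrow> y' \<in> lp_space p J \<Longrightarrow>
        \<bar>f w y - f w y'\<bar> \<le> lp_norm p J (y - y')"
    and cont: "\<And>F y. finite F \<Longrightarrow> F \<subseteq> J \<Longrightarrow> (\<And>j. j \<notin> F \<Longrightarrow> y j = 0) \<Longrightarrow> continuous_on K (\<lambda>w. f w y)"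
  shows "continuous_on K (\<lambda>w. f w x)"
proof (rule uniform_limit_theorem[where F = "finite_subsets_at_top J"])
  let ?y = "\<lambda>F j. if j \<in> F then x j else 0"
  have fin: "\<forall>\<^sub>F F in finite_subsets_at_top J. finite F \<and> F \<subseteq> J"
    by (auto simp: eventually_finite_subsets_at_top)
  then show "\<forall>\<^sub>F F in finite_subsets_at_top J. continuous_on K (\<lambda>w. f w (?y F))"
    by eventually_elim (rule cont, auto)
  show "uniform_limit K (\<lambda>F w. f w (?y F)) (\<lambda>w. f w x) (finite_subsets_at_top J)"
  proof (rule uniform_limitI)
    fix e :: real assume "0 < e"
    then have "\<forall>\<^sub>F F in finite_subsets_at_top J. lp_norm p J (x - ?y F) < e"
      using order_tendstoD(2)[OF truncation_tendsto[OF p x]] by blast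
    with fin show "\<forall>\<^sub>F F in finite_subsets_at_top J. \<forall>w\<in>K. dist (f w (?y F)) (f w x) < e"
    proof eventually_elim
      case (elim F)
      have "?y F \<in> lp_space p J"
        using elim by (intro finite_support_in_lp_space[of F]) auto
      then show ?case
        using nonexp[OF _ x, of _ "?y F"] elim by (fastforce simp: dist_real_def abs_minus_commute)
    qed
  qed
qed simp

lemma continuous_on_coord:
  "continuous_on S (\<lambda>w. fst w j)" for S :: "(('j \<Rightarrow> real) \<times> 'b::topological_space) set"
  by (rule continuous_on_product_then_coordinatewise) (rule continuous_on_fst[OF continuous_on_id])

lemma continuous_on_h_polar:
  assumes p: "1 < p" and x: "x \<in> lp_space p J"
  shows "continuous_on (lp_ball p J \<times> {0..1}) (\<lambda>w. h_polar p J (fst w) (snd w) x)"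
proof (rule continuous_on_finite_support_limit[OF p x])
  fix F y assume F: "finite F" "F \<subseteq> J" and y: "\<And>j. j \<notin> F \<Longrightarrow> y j = (0::real)"
  let ?b = "\<lambda>w :: ('a \<Rightarrow> real) \<times> real.
    (\<Sum>j\<in>F. \<bar>y j - snd w * fst w j\<bar> powr p - \<bar>snd w * fst w j\<bar> powr p) + snd w powr p"
  have nonneg: "0 \<le> ?b w" if "w \<in> lp_ball p J \<times> {0..1}" for w
  proof -
    have "(\<Sum>j\<in>F. \<bar>snd w * fst w j\<bar> powr p) = snd w powr p * (\<Sum>j\<in>F. \<bar>fst w j\<bar> powr p)"
      using that by (auto simp: abs_mult powr_mult sum_distrib_left)
    also have "\<dots> \<le> snd w powr p * 1"
      using that p by (intro mult_left_mono lp_ball_sum_le[OF _ _ F]) auto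
    finally have "(\<Sum>j\<in>F. \<bar>snd w * fst w j\<bar> powr p) \<le> snd w powr p" by simp
    moreover have "0 \<le> (\<Sum>j\<in>F. \<bar>y j - snd w * fst w j\<bar> powr p)" by (rule sum_nonneg) simp
    ultimately show ?thesis by (simp add: sum_subtractf)
  qed
  have snd: "continuous_on (lp_ball p J \<times> {0..1}) (\<lambda>w. snd w powr p)"
    using p by (intro continuous_on_powr' continuous_on_snd continuous_on_id continuous_on_const) auto
  have "continuous_on (lp_ball p J \<times> {0..1}) ?b"
    using p by (intro snd continuous_on_add continuous_on_sum continuous_on_diff continuous_on_mult continuous_on_abs_powr
        continuous_on_coord continuous_on_snd continuous_on_id continuous_on_const) simp_all
  then have "continuous_on (lp_ball p J \<times> {0..1}) (\<lambda>w. ?b w powr (1 / p) - snd w)"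
  proof (intro continuous_on_diff continuous_on_powr' continuous_on_snd continuous_on_id continuous_on_const ballI conjI impI)
    show "0 < 1 / p" using p by simp
  qed (assumption | erule nonneg)+
  moreover have "?b w powr (1 / p) - snd w = h_polar p J (fst w) (snd w) y"
    if w: "w \<in> lp_ball p J \<times> {0..1}" for w
  proof -
    have "(\<lambda>j. snd w * fst w j) \<in> lp_space p J"
      using p w by (intro scale_lp_ball(1)) auto
    then show ?thesis
      unfolding h_polar_def by (subst h_zc_finite_support[OF p _ F y]) simp_all
  qed
  ultimately show "continuous_on (lp_ball p J \<times> {0..1}) (\<lambda>w. h_polar p J (fst w) (snd w) y)"
    by (rule continuous_on_eq)
next
  fix w y y'
  assume "w \<in> lp_ball p J \<times> {0..1::real}" "y \<in> lp_space p J" "y' \<in> lp_space p J"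
  then show "\<bar>h_polar p J (fst w) (snd w) y - h_polar p J (fst w) (snd w) y'\<bar> \<le> lp_norm p J (y - y')"
    by (intro h_polar_nonexpansive[OF p]) auto
qed

text \<open>
  For \<open>s > 0\<close> and \<open>y\<close> supported on \<open>F\<close>, taking the factor \<open>t = 1/s\<close> out of the root gives
  \<open>((1 + D)\<^bsup>1/p\<^esup> - 1)/s\<close> with \<open>D = (\<Sum>j\<in>F. \<bar>s y\<^sub>j - u\<^sub>j\<bar>\<^sup>p - \<bar>u\<^sub>j\<bar>\<^sup>p)\<close>.  This \<open>D\<close> vanishes at \<open>s = 0\<close>.
  Divided differences of \<open>\<bar>\<cdot>\<bar>\<^sup>p\<close> give \<open>D = - s A\<close> with \<open>A\<close> continuous, and \<open>(1 + D)\<^bsup>1/p\<^esup> - 1 = g (1 + D) D\<close>;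
  the division by \<open>s\<close> then cancels, leaving \<open>- g (1 + D) A\<close>, which is continuous at \<open>s = 0\<close> as well.
  There \<open>g\<close> contributes \<open>1/p\<close> and \<open>A\<close> contributes \<open>p\<close> times the pairing of \<open>y\<close> with the duality map.
\<close>
lemma continuous_on_h_polar_inverse:
  assumes p: "1 < p" "1 < q" "1 / p + 1 / q = 1" and x: "x \<in> lp_space p J"
  shows "continuous_on (lp_ball p J \<times> {0..1}) (\<lambda>w. h_polar_inverse p J (fst w) (snd w) x)"
proof (rule continuous_on_finite_support_limit[OF p(1) x])
  fix F y assume F: "finite F" "F \<subseteq> J" and y: "\<And>j. j \<notin> F \<Longrightarrow> y j = (0::real)"
  let ?K = "lp_ball p J \<times> {0..1::real}"
  define Q where "Q = divided_difference (\<lambda>x. \<bar>x\<bar> powr p) (\<lambda>x. p * (sgn x * \<bar>x\<bar> powr (p - 1)))"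
  obtain g where g: "\<And>y. y powr (1 / p) - 1 = g y * (y - 1)" "g 1 = 1 / p" "continuous_on {0..} g"
    using root_difference_quotient[of p] p by auto
  have Q: "continuous_on UNIV (\<lambda>w. Q (fst w) (snd w))"
    unfolding Q_def using p
    by (intro continuous_on_divided_difference has_real_derivative_abs_powr continuous_intros continuous_on_signed_powr) auto
  define D where "D = (\<lambda>w :: ('a \<Rightarrow> real) \<times> real. \<Sum>j\<in>F. \<bar>snd w * y j - fst w j\<bar> powr p - \<bar>fst w j\<bar> powr p)"
  define A where "A = (\<lambda>w :: ('a \<Rightarrow> real) \<times> real. \<Sum>j\<in>F. y j * Q (fst w j - snd w * y j) (fst w j))"
  have DA: "D w = - snd w * A w" for w
  proof -
    have "\<bar>snd w * y j - fst w j\<bar> powr p - \<bar>fst w j\<bar> powr p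
        = - snd w * (y j * Q (fst w j - snd w * y j) (fst w j))" for j
    proof -
      have "Q a b * (a - b) = \<bar>a\<bar> powr p - \<bar>b\<bar> powr p" for a b
        unfolding Q_def by (rule divided_difference_mult)
      moreover have "fst w j - snd w * y j - fst w j = - (snd w * y j)"
        by simp
      ultimately have "\<bar>fst w j - snd w * y j\<bar> powr p - \<bar>fst w j\<bar> powr p
          = Q (fst w j - snd w * y j) (fst w j) * - (snd w * y j)"
        by metis
      then show ?thesis
        by (simp only: abs_minus_commute[of "snd w * y j"] mult_minus_left mult_minus_right mult_ac)
    qed
    then show ?thesis
      unfolding D_def A_def by (simp only: sum_distrib_left)
  qed
  have Dge: "0 \<le> 1 + D w" if "w \<in> ?K" for w
  proof -
    have "(\<Sum>j\<in>F. \<bar>fst w j\<bar> powr p) \<le> 1"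
      using that p by (intro lp_ball_sum_le[OF _ _ F]) auto
    moreover have "0 \<le> (\<Sum>j\<in>F. \<bar>snd w * y j - fst w j\<bar> powr p)" by (rule sum_nonneg) simp
    ultimately show ?thesis by (simp add: D_def sum_subtractf)
  qed
  have cD: "continuous_on ?K (\<lambda>w. 1 + D w)"
    unfolding D_def using p
    by (intro continuous_on_add continuous_on_sum continuous_on_diff continuous_on_mult continuous_on_abs_powr
        continuous_on_coord continuous_on_snd continuous_on_id continuous_on_const) simp_all
  have cA: "continuous_on ?K A"
    unfolding A_def
    by (intro continuous_on_sum continuous_on_mult continuous_on_const
        continuous_on_compose2[OF Q, where f = "\<lambda>w. (fst w j - snd w * y j, fst w j)" for j, simplified]
        continuous_on_Pair continuous_on_diff continuous_on_coord continuous_on_snd continuous_on_id)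
  have "continuous_on ?K (\<lambda>w. - (g (1 + D w) * A w))"
    using Dge by (intro continuous_on_minus continuous_on_mult cA continuous_on_compose2[OF g(3) cD]) auto
  moreover have "- (g (1 + D w) * A w) = h_polar_inverse p J (fst w) (snd w) y" if w: "w \<in> ?K" for w
  proof (cases "snd w = 0")
    case True
    have ym: "y \<in> lp_space p J" by (rule finite_support_in_lp_space) (use F y in auto)
    have "(\<Sum>\<^sub>\<infinity>j\<in>J. duality_map p (fst w) j * y j) = (\<Sum>j\<in>F. duality_map p (fst w) j * y j)"
      using F y by (intro infsum_finite_support) auto
    moreover have "A w = p * (\<Sum>j\<in>F. duality_map p (fst w) j * y j)"
      by (simp add: A_def Q_def True divided_difference_def duality_map_def sum_distrib_left mult_ac)
    ultimately show ?thesis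
      using True p ym g(2) by (simp add: h_polar_inverse_def h_mu_def DA)
  next
    case False
    then have s: "0 < snd w" using w by auto
    define t where "t = 1 / snd w"
    have t: "0 < t" "t * snd w = 1" using s by (simp_all add: t_def)
    have "\<bar>y j - t * fst w j\<bar> powr p - \<bar>t * fst w j\<bar> powr p
        = t powr p * (\<bar>snd w * y j - fst w j\<bar> powr p - \<bar>fst w j\<bar> powr p)" for j
    proof -
      have eq: "y j - t * fst w j = t * (snd w * y j - fst w j)"
        using t(2) by (simp add: right_diff_distrib flip: mult.assoc)
      show ?thesis unfolding eq using t(1) by (simp add: abs_mult powr_mult flip: right_diff_distrib)
    qed
    then have "(\<Sum>j\<in>F. \<bar>y j - t * fst w j\<bar> powr p - \<bar>t * fst w j\<bar> powr p) + t powr p = t powr p * (1 + D w)"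
      by (simp add: D_def sum_distrib_left distrib_left)
    then have "h_polar p J (fst w) t y = (t powr p * (1 + D w)) powr (1 / p) - t"
      unfolding h_polar_def using w p t
      by (subst h_zc_finite_support[OF p(1) _ F y]) (auto intro: scale_lp_ball(1))
    also have "\<dots> = t * ((1 + D w) powr (1 / p) - 1)"
      using t p Dge[OF w] by (simp add: powr_mult powr_powr right_diff_distrib)
    also have "\<dots> = t * (g (1 + D w) * D w)"
      by (simp add: g(1))
    also have "\<dots> = - (t * snd w * (g (1 + D w) * A w))"
      by (simp add: DA mult_ac)
    finally show ?thesis
      using False t by (simp add: h_polar_inverse_def t_def)
  qed
  ultimately show "continuous_on ?K (\<lambda>w. h_polar_inverse p J (fst w) (snd w) y)"
    by (rule continuous_on_eq)
next
  fix w y y'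
  assume "w \<in> lp_ball p J \<times> {0..1::real}" "y \<in> lp_space p J" "y' \<in> lp_space p J"
  then show "\<bar>h_polar_inverse p J (fst w) (snd w) y - h_polar_inverse p J (fst w) (snd w) y'\<bar> \<le> lp_norm p J (y - y')"
    by (intro h_polar_inverse_nonexpansive[OF p]) auto
qed

section \<open>The unit ball in the topology of coordinatewise convergence\<close>

text \<open>
  Each condition involves finitely many coordinates, so the ball is closed for coordinatewise
  convergence.
\<close>
lemma lp_ball_iff:
  assumes "0 < p"
  shows "u \<in> lp_ball p J \<longleftrightarrow>
    (\<forall>j. j \<notin> J \<longrightarrow> u j = 0) \<and> (\<forall>F. finite F \<and> F \<subseteq> J \<longrightarrow> (\<Sum>j\<in>F. \<bar>u j\<bar> powr p) \<le> 1)"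
    (is "_ \<longleftrightarrow> ?Z \<and> ?S")
proof
  assume u: "u \<in> lp_ball p J"
  then show "?Z \<and> ?S"
    using lp_ball_sum_le[OF assms] by (auto simp: lp_ball_def lp_space_def)
next
  assume A: "?Z \<and> ?S"
  then have "bdd_above ((\<lambda>F. \<Sum>j\<in>F. \<bar>u j\<bar> powr p) ` {F. finite F \<and> F \<subseteq> J})"
    by (intro bdd_aboveI2[of _ _ 1]) auto
  then have u: "u \<in> lp_space p J"
    using A by (simp add: lp_space_iff_bdd_above)
  then have "(\<Sum>\<^sub>\<infinity>j\<in>J. \<bar>u j\<bar> powr p) \<le> 1"
    using A by (intro infsum_le_finite_sums) (auto simp: lp_space_def)
  then show "u \<in> lp_ball p J"
    using u assms lp_norm_le_iff[of p 1 J u] by (simp add: lp_ball_def)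
qed

text \<open>
  A closed subset of the cube \<open>[-1, 1]\<^sup>J\<close>, which is compact by Tychonoff's theorem.
\<close>
lemma compact_lp_ball:
  fixes J :: "'j set"
  assumes p: "0 < p"
  shows "compact (lp_ball p J)"
proof -
  have "compactin (product_topology (\<lambda>_. euclideanreal) (UNIV :: 'j set)) (\<Pi>\<^sub>E j\<in>UNIV. {-1..1})"
    by (simp add: compactin_PiE)
  then have cube: "compact (\<Pi>\<^sub>E j\<in>(UNIV :: 'j set). {-1..1::real})"
    by (simp add: euclidean_product_topology)
  have "closed {u :: 'j \<Rightarrow> real. u j = 0}" for j
    by (intro closed_Collect_eq continuous_on_product_coordinates continuous_on_const)
  moreover have "closed {u :: 'j \<Rightarrow> real. (\<Sum>j\<in>F. \<bar>u j\<bar> powr p) \<le> 1}" for F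
    using p by (intro closed_Collect_le continuous_on_sum continuous_on_abs_powr
        continuous_on_product_coordinates continuous_on_const)
  ultimately have "closed ((\<Inter>j\<in>- J. {u. u j = 0}) \<inter>
      (\<Inter>F\<in>{F. finite F \<and> F \<subseteq> J}. {u :: 'j \<Rightarrow> real. (\<Sum>j\<in>F. \<bar>u j\<bar> powr p) \<le> 1}))"
    by (intro closed_Int closed_INT ballI)
  moreover have "(\<Inter>j\<in>- J. {u. u j = 0}) \<inter>
      (\<Inter>F\<in>{F. finite F \<and> F \<subseteq> J}. {u :: 'j \<Rightarrow> real. (\<Sum>j\<in>F. \<bar>u j\<bar> powr p) \<le> 1}) = lp_ball p J"
    using p by (auto simp: lp_ball_iff)
  ultimately have cl: "closed (lp_ball p J)" by simp
  have "u j \<in> {-1..1}" if u: "u \<in> lp_ball p J" for u :: "'j \<Rightarrow> real" and j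
  proof (cases "j \<in> J")
    case True
    then have "\<bar>u j\<bar> powr p \<le> 1"
      using u[unfolded lp_ball_iff[OF p]] by (auto dest: spec[of _ "{j}"])
    moreover have "1 powr p < \<bar>u j\<bar> powr p" if "1 < \<bar>u j\<bar>"
      using p that by (intro powr_less_mono2) auto
    ultimately have "\<not> 1 < \<bar>u j\<bar>" by fastforce
    then show ?thesis by auto
  next
    case False
    then show ?thesis using u by (simp add: lp_ball_def lp_space_def)
  qed
  then have "lp_ball p J \<subseteq> (\<Pi>\<^sub>E j\<in>UNIV. {-1..1})" by auto
  then show ?thesis
    using compact_Int_closed[OF cube cl] by (simp add: Int_absorb1)
qed

definition lp_sphere :: "real \<Rightarrow> 'j set \<Rightarrow> ('j \<Rightarrow> real) set" where
  "lp_sphere p J = {u \<in> lp_space p J. lp_norm p J u = 1}"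

lemma lp_sphere_subset_ball: "lp_sphere p J \<subseteq> lp_ball p J"
  by (auto simp: lp_sphere_def lp_ball_def)

text \<open>
  Truncate \<open>u\<close> to a finite set \<open>F\<close> and place the missing mass at a single new index outside \<open>F\<close>.
  Such an index exists because \<open>J\<close> is infinite, and as \<open>F\<close> grows it leaves every fixed coordinate.
\<close>
lemma lp_ball_subset_closure_sphere:
  assumes J: "infinite J" and p: "0 < p"
  shows "lp_ball p J \<subseteq> closure (lp_sphere p J)"
proof
  fix u assume u: "u \<in> lp_ball p J"
  define i where "i F = (SOME i. i \<in> J - F)" for F
  have i: "i F \<in> J - F" if "finite F" for F
  proof -
    have "infinite (J - F)" using Diff_infinite_finite[OF that J] .
    then have "\<exists>i. i \<in> J - F" using infinite_imp_nonempty by blast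
    then show ?thesis unfolding i_def by (rule someI_ex)
  qed
  define v where "v F j = (if j \<in> F then u j else if j = i F then (1 - (\<Sum>j\<in>F. \<bar>u j\<bar> powr p)) powr (1 / p) else 0)" for F j
  have fin: "\<forall>\<^sub>F F in finite_subsets_at_top J. finite F \<and> F \<subseteq> J"
    by (auto simp: eventually_finite_subsets_at_top)
  show "u \<in> closure (lp_sphere p J)"
  proof (rule Lim_in_closed_set)
    show "\<forall>\<^sub>F F in finite_subsets_at_top J. v F \<in> closure (lp_sphere p J)"
      using fin
    proof eventually_elim
      case (elim F)
      have iF: "i F \<in> J" "i F \<notin> F" using i elim by auto
      have le: "(\<Sum>j\<in>F. \<bar>u j\<bar> powr p) \<le> 1"
        using u elim p by (auto simp: lp_ball_iff)
      have mem: "v F \<in> lp_space p J"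
        using elim iF by (intro finite_support_in_lp_space[of "insert (i F) F"]) (auto simp: v_def)
      have "(\<Sum>\<^sub>\<infinity>j\<in>J. \<bar>v F j\<bar> powr p) = (\<Sum>j\<in>insert (i F) F. \<bar>v F j\<bar> powr p)"
        using elim iF by (intro infsum_finite_support) (auto simp: v_def)
      also have "\<dots> = \<bar>v F (i F)\<bar> powr p + (\<Sum>j\<in>F. \<bar>v F j\<bar> powr p)"
        using elim iF by simp
      also have "(\<Sum>j\<in>F. \<bar>v F j\<bar> powr p) = (\<Sum>j\<in>F. \<bar>u j\<bar> powr p)"
        by (simp add: v_def)
      also have "\<bar>v F (i F)\<bar> powr p = 1 - (\<Sum>j\<in>F. \<bar>u j\<bar> powr p)"
        using iF le p by (simp add: v_def powr_powr)
      finally have "lp_norm p J (v F) = 1"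
        by (simp add: lp_norm_def)
      then show ?case
        using mem closure_subset by (fastforce simp: lp_sphere_def)
    qed
    have "((\<lambda>F. v F j) \<longlongrightarrow> u j) (finite_subsets_at_top J)" for j
    proof (rule tendsto_eventually)
      show "\<forall>\<^sub>F F in finite_subsets_at_top J. v F j = u j"
      proof (cases "j \<in> J")
        case True
        then show ?thesis
          unfolding eventually_finite_subsets_at_top by (intro exI[of _ "{j}"]) (auto simp: v_def)
      next
        case False
        then have uj: "u j = 0" using u by (simp add: lp_ball_def lp_space_def)
        show ?thesis
          using fin
        proof eventually_elim
          case (elim F)
          then show ?case using i[of F] False uj by (auto simp: v_def)
        qed
      qed
    qed
    then show "(v \<longlongrightarrow> u) (finite_subsets_at_top J)"
      using limitin_componentwise[of "\<lambda>_. euclideanreal" UNIV v u "finite_subsets_at_top J"]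
      by (simp add: euclidean_product_topology)
  qed simp_all
qed

section \<open>The metric compactification\<close>

definition metric_limits :: "real \<Rightarrow> real \<Rightarrow> 'j set \<Rightarrow> (('j \<Rightarrow> real) \<Rightarrow> real) set" where
  "metric_limits p q J =
     {h_zc p J z c | z c. z \<in> lp_space p J \<and> lp_norm p J z \<le> c} \<union> h_mu p J ` lp_ball q J"

text \<open>
  Radii \<open>c \<le> 1\<close> lie in the first chart, radii \<open>c \<ge> 1\<close> in the second as \<open>s = 1/c\<close>, and every \<open>\<mu>\<close>
  in the unit ball of \<open>\<ell>\<^sub>q\<close> is a value of the duality map.
\<close>
lemma metric_limits_charts:
  assumes p: "1 < p" "1 < q" "1 / p + 1 / q = 1"
  shows "metric_limits p q J =
    (\<lambda>w. h_polar p J (fst w) (snd w)) ` (lp_ball p J \<times> {0..1}) \<union>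
    (\<lambda>w. h_polar_inverse p J (fst w) (snd w)) ` (lp_ball p J \<times> {0..1})" (is "_ = ?A \<union> ?B")
proof
  have polar: "h_polar p J u t \<in> metric_limits p q J" if "u \<in> lp_ball p J" "0 \<le> t" for u t
    using scale_lp_ball[OF _ that] p unfolding h_polar_def metric_limits_def by auto
  have "h_polar_inverse p J u s \<in> metric_limits p q J" if u: "u \<in> lp_ball p J" and "0 \<le> s" for u s
  proof (cases "s = 0")
    case True
    then show ?thesis
      using duality_map_ball[OF p u] by (simp add: h_polar_inverse_def metric_limits_def)
  next
    case False
    then show ?thesis
      using polar[of u "1 / s"] that by (simp add: h_polar_inverse_def)
  qed
  with polar show "?A \<union> ?B \<subseteq> metric_limits p q J" by auto
next
  have q: "1 / q + 1 / p = 1" using p by simp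
  have zc: "h_zc p J z c \<in> ?A \<union> ?B" if z: "z \<in> lp_space p J" and c: "lp_norm p J z \<le> c" for z c
  proof (cases "c = 0")
    case True
    then have "lp_norm p J z = 0" using c lp_norm_nonneg[of p J z] by simp
    then have z0: "z = (\<lambda>_. 0)" using lp_norm_eq_0D[of p z J] z p by simp
    then have "h_zc p J z c = h_polar p J z 0"
      using True by (simp add: h_polar_def)
    moreover have "z \<in> lp_ball p J"
      using z c True by (simp add: lp_ball_def)
    ultimately show ?thesis by (force intro!: image_eqI[of _ _ "(z, 0)"])
  next
    case False
    then have c0: "0 < c" using c lp_norm_nonneg[of p J z] by linarith
    define u where "u = (\<lambda>j. (1 / c) * z j)"
    have "lp_norm p J u = (1 / c) * lp_norm p J z"
      unfolding u_def using p c0 by (subst lp_norm_scale) auto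
    then have u: "u \<in> lp_ball p J"
      using z c c0 lp_space_scale[of z p J "1 / c"] by (simp add: lp_ball_def u_def)
    have eq: "h_zc p J z c = h_polar p J u c"
      using c0 by (simp add: h_polar_def u_def)
    show ?thesis
    proof (cases "c \<le> 1")
      case True
      then have "h_zc p J z c \<in> ?A"
        using u c0 eq by (intro image_eqI[of _ _ "(u, c)"]) auto
      then show ?thesis ..
    next
      case False
      then have "h_zc p J z c \<in> ?B"
        using u c0 eq by (intro image_eqI[of _ _ "(u, 1 / c)"]) (auto simp: h_polar_inverse_def)
      then show ?thesis ..
    qed
  qed
  have "h_mu p J \<mu> \<in> ?B" if "\<mu> \<in> lp_ball q J" for \<mu>
    using duality_map_ball[OF p(2,1) q that] duality_map_inverse[OF p, of \<mu>]
    by (intro image_eqI[of _ _ "(duality_map q \<mu>, 0)"]) (auto simp: h_polar_inverse_def)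
  with zc show "metric_limits p q J \<subseteq> ?A \<union> ?B"
    unfolding metric_limits_def by blast
qed

lemma h_polar_extensional: "h_polar p J u t \<in> extensional (lp_space p J)"
  by (simp add: h_polar_def h_zc_def)

lemma h_polar_inverse_extensional: "h_polar_inverse p J u s \<in> extensional (lp_space p J)"
  by (simp add: h_polar_inverse_def h_polar_extensional) (simp add: h_mu_def)

lemma continuous_map_h_polar:
  assumes "1 < p"
  shows "continuous_map (top_of_set (lp_ball p J \<times> {0..1})) (powertop_real (lp_space p J))
    (\<lambda>w. h_polar p J (fst w) (snd w))"
  using continuous_on_h_polar[OF assms]
  by (auto simp: continuous_map_componentwise h_polar_extensional)

lemma continuous_map_h_polar_inverse:
  assumes "1 < p" "1 < q" "1 / p + 1 / q = 1"
  shows "continuous_map (top_of_set (lp_ball p J \<times> {0..1})) (powertop_real (lp_space p J))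
    (\<lambda>w. h_polar_inverse p J (fst w) (snd w))"
  using continuous_on_h_polar_inverse[OF assms]
  by (auto simp: continuous_map_componentwise h_polar_inverse_extensional)

lemma image_subset_closure_of_dense_image:
  assumes f: "continuous_map (top_of_set K) Y f" and "S \<subseteq> K" "K \<subseteq> closure S"
    and "f ` S \<subseteq> H"
  shows "f ` K \<subseteq> Y closure_of H"
proof -
  have "top_of_set K closure_of S = K"
    using assms(2,3) by (simp add: closure_of_subtopology Int_absorb1 Int_absorb2)
  then have "f ` K \<subseteq> Y closure_of (f ` S)"
    using continuous_map_image_closure_subset[OF f, of S] by simp
  also have "\<dots> \<subseteq> Y closure_of H"
    by (rule closure_of_mono[OF assms(4)])
  finally show ?thesis .
qed

lemma h_polar_sphere_internal:
  assumes "0 < p" "u \<in> lp_sphere p J" "0 \<le> t"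
  shows "h_polar p J u t \<in> {internal_functional (lp_space p J) (lp_norm p J) y | y. y \<in> lp_space p J}"
proof -
  have "lp_norm p J (\<lambda>j. t * u j) = t" "(\<lambda>j. t * u j) \<in> lp_space p J"
    using assms by (auto simp: lp_norm_scale lp_sphere_def intro: lp_space_scale)
  then show ?thesis
    using h_zc_lp_norm_eq_internal[OF assms(1), of J "\<lambda>j. t * u j"] by (auto simp: h_polar_def)
qed

theorem metric_compactification_lp:
  assumes J: "infinite J" and p: "1 < p" "1 < q" "1 / p + 1 / q = 1"
  shows "metric_compactification (lp_space p J) (lp_norm p J) = metric_limits p q J"
proof -
  let ?K = "lp_ball p J \<times> {0..1::real}" and ?Y = "powertop_real (lp_space p J)"
  let ?f = "\<lambda>w. h_polar p J (fst w) (snd w)" and ?g = "\<lambda>w. h_polar_inverse p J (fst w) (snd w)"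
  let ?H = "{internal_functional (lp_space p J) (lp_norm p J) y | y. y \<in> lp_space p J}"
  have f: "continuous_map (top_of_set ?K) ?Y ?f" and g: "continuous_map (top_of_set ?K) ?Y ?g"
    using p continuous_map_h_polar continuous_map_h_polar_inverse by blast+
  have K: "compactin (top_of_set ?K) ?K"
    using compact_Times[OF compact_lp_ball[of p J] compact_Icc[of 0 1]] p by (simp add: compactin_subtopology)
  have Hd: "Hausdorff_space ?Y"
    by (simp add: Hausdorff_space_product_topology)
  have "compactin ?Y (metric_limits p q J)"
    unfolding metric_limits_charts[OF p]
    by (intro compactin_Un image_compactin[OF K f] image_compactin[OF K g])
  then have "closedin ?Y (metric_limits p q J)"
    by (rule compactin_imp_closedin[OF Hd])
  moreover have "?H \<subseteq> metric_limits p q J"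
  proof clarify
    fix y assume "y \<in> lp_space p J"
    then have "h_zc p J y (lp_norm p J y) \<in> metric_limits p q J"
      unfolding metric_limits_def by blast
    then show "internal_functional (lp_space p J) (lp_norm p J) y \<in> metric_limits p q J"
      using p by (simp add: h_zc_lp_norm_eq_internal)
  qed
  ultimately have "?Y closure_of ?H \<subseteq> metric_limits p q J"
    by (intro closure_of_minimal)
  moreover have "?f ` ?K \<subseteq> ?Y closure_of ?H"
  proof (rule image_subset_closure_of_dense_image[OF f])
    show "lp_sphere p J \<times> {0..1} \<subseteq> ?K" using lp_sphere_subset_ball by blast
    show "?K \<subseteq> closure (lp_sphere p J \<times> {0..1})"
      unfolding closure_Times using lp_ball_subset_closure_sphere[OF J, of p] p by auto
    show "?f ` (lp_sphere p J \<times> {0..1}) \<subseteq> ?H"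
      using h_polar_sphere_internal[of p] p by fastforce
  qed
  moreover have "?g ` ?K \<subseteq> ?Y closure_of ?H"
  proof (rule image_subset_closure_of_dense_image[OF g])
    \<comment> \<open>The chart value at \<open>s = 0\<close> is not the functional of a point, so \<open>0\<close> is left out and recovered in
      the closure of \<open>(0, 1]\<close>.\<close>
    show "lp_sphere p J \<times> {0<..1} \<subseteq> ?K" using lp_sphere_subset_ball by fastforce
    show "?K \<subseteq> closure (lp_sphere p J \<times> {0<..1})"
      unfolding closure_Times using lp_ball_subset_closure_sphere[OF J, of p] p by auto
    have "h_polar_inverse p J u s \<in> ?H" if "u \<in> lp_sphere p J" "0 < s" for u s
      using h_polar_sphere_internal[of p u J "1 / s"] that p by (simp add: h_polar_inverse_def)
    then show "?g ` (lp_sphere p J \<times> {0<..1}) \<subseteq> ?H"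
      by fastforce
  qed
  ultimately show ?thesis
    unfolding metric_compactification_def using metric_limits_charts[OF p, of J] by auto
qed

section \<open>Finite functionals and functionals at infinity\<close>

lemma INF_h_zc_finite: "(INF x\<in>lp_space p J. ereal (h_zc p J z c x)) > - \<infinity>"
proof -
  have "ereal (- c) \<le> (INF x\<in>lp_space p J. ereal (h_zc p J z c x))"
    by (rule INF_greatest) (simp add: h_zc_def)
  then show ?thesis by (metis less_ereal.simps(5) order_less_le_trans)
qed

text \<open>
  Multiples of a coordinate vector at some \<open>j\<close> with \<open>\<mu> j \<noteq> 0\<close> take every real value.
\<close>
lemma INF_h_mu_infinite:
  assumes "\<mu> \<in> lp_space q J" "0 < lp_norm q J \<mu>"
  shows "(INF x\<in>lp_space p J. ereal (h_mu p J \<mu> x)) = - \<infinity>"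
proof (rule ereal_bot)
  fix B :: real
  have "\<exists>j\<in>J. \<mu> j \<noteq> 0"
  proof (rule ccontr)
    assume "\<not> (\<exists>j\<in>J. \<mu> j \<noteq> 0)"
    then have "(\<Sum>\<^sub>\<infinity>j\<in>J. \<bar>\<mu> j\<bar> powr q) = (\<Sum>\<^sub>\<infinity>j\<in>J. 0)"
      by (intro infsum_cong) auto
    then show False using assms(2) by (simp add: lp_norm_def)
  qed
  then obtain j where j: "j \<in> J" "\<mu> j \<noteq> 0" by blast
  define x where "x = (\<lambda>i. if i = j then - B / \<mu> j else 0)"
  have x: "x \<in> lp_space p J"
    by (rule finite_support_in_lp_space[of "{j}"]) (use j in \<open>auto simp: x_def\<close>)
  have "(\<Sum>\<^sub>\<infinity>i\<in>J. \<mu> i * x i) = (\<Sum>i\<in>{j}. \<mu> i * x i)"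
    using j by (intro infsum_finite_support) (auto simp: x_def)
  then have "h_mu p J \<mu> x = B"
    using j x by (simp add: h_mu_def x_def)
  then show "(INF x\<in>lp_space p J. ereal (h_mu p J \<mu> x)) \<le> ereal B"
    using x by (intro INF_lower2[of x]) auto
qed

lemma h_mu_eq_0:
  assumes "0 < q" "\<mu> \<in> lp_space q J" "lp_norm q J \<mu> = 0"
  shows "h_mu p J \<mu> = (\<lambda>x\<in>lp_space p J. 0)"
  using lp_norm_eq_0D[OF assms] by (simp add: h_mu_def)

theorem theorem5p4:
  fixes J :: "'j set" and p q :: real
  assumes "infinite J"
    and "1 < p" and "1 < q"
    and "1 / p + 1 / q = 1"
  shows "metric_compactification (lp_space p J) (lp_norm p J) =
           finite_metric_functionals (lp_space p J) (lp_norm p J) \<union>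
           metric_functionals_at_infinity (lp_space p J) (lp_norm p J)
       \<and> finite_metric_functionals (lp_space p J) (lp_norm p J) \<inter>
           metric_functionals_at_infinity (lp_space p J) (lp_norm p J) = {}
       \<and> finite_metric_functionals (lp_space p J) (lp_norm p J) =
           {h_zc p J z c | z c. z \<in> lp_space p J \<and> c \<ge> lp_norm p J z} \<union>
           {\<lambda>x\<in>lp_space p J. 0}
       \<and> metric_functionals_at_infinity (lp_space p J) (lp_norm p J) =
           {h_mu p J \<mu> | \<mu>. \<mu> \<in> lp_space q J \<and> 0 < lp_norm q J \<mu> \<and> lp_norm q J \<mu> \<le> 1}"
proof -
  let ?X = "lp_space p J" and ?N = "lp_norm p J"
  let ?ZC = "{h_zc p J z c | z c. z \<in> ?X \<and> c \<ge> ?N z}" and ?O = "\<lambda>x\<in>?X. 0 :: real"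
  let ?MU = "{h_mu p J \<mu> | \<mu>. \<mu> \<in> lp_space q J \<and> 0 < lp_norm q J \<mu> \<and> lp_norm q J \<mu> \<le> 1}"
  let ?fin = "\<lambda>h. (INF x\<in>?X. ereal (h x)) > - \<infinity>"
  have "h_mu p J ` lp_ball q J = {?O} \<union> ?MU"
  proof
    show "h_mu p J ` lp_ball q J \<subseteq> {?O} \<union> ?MU"
    proof
      fix h assume "h \<in> h_mu p J ` lp_ball q J"
      then obtain \<mu> where m: "h = h_mu p J \<mu>" "\<mu> \<in> lp_space q J" "lp_norm q J \<mu> \<le> 1"
        by (auto simp: lp_ball_def)
      show "h \<in> {?O} \<union> ?MU"
      proof (cases "lp_norm q J \<mu> = 0")
        case True
        then show ?thesis using m h_mu_eq_0[of q \<mu> J p] assms(3) by simp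
      next
        case False
        then have "0 < lp_norm q J \<mu>" by (simp add: less_le)
        then show ?thesis using m by blast
      qed
    qed
    have 0: "(\<lambda>_. 0) \<in> lp_space q J" "lp_norm q J (\<lambda>_. 0) = 0"
      by (simp_all add: lp_space_def lp_norm_def)
    then have "?O \<in> h_mu p J ` lp_ball q J"
      using h_mu_eq_0[OF _ 0, of p] assms(3) by (intro image_eqI[of _ _ "\<lambda>_. 0"]) (auto simp: lp_ball_def)
    then show "{?O} \<union> ?MU \<subseteq> h_mu p J ` lp_ball q J"
      by (auto simp: lp_ball_def)
  qed
  then have MC: "metric_compactification ?X ?N = ?ZC \<union> {?O} \<union> ?MU"
    unfolding metric_compactification_lp[OF assms] metric_limits_def by auto
  have "(\<lambda>_. 0) \<in> ?X" by (simp add: lp_space_def)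
  then have "(INF x\<in>?X. ereal (?O x)) = 0"
    by (auto intro!: INF_eq_const)
  then have fin: "?fin h" if "h \<in> ?ZC \<union> {?O}" for h
    using that INF_h_zc_finite by auto
  have inf: "(INF x\<in>?X. ereal (h x)) = - \<infinity>" if "h \<in> ?MU" for h
    using that INF_h_mu_infinite by blast
  have separate: "{h \<in> A \<union> B. I h > - \<infinity>} = A \<and> {h \<in> A \<union> B. I h = - \<infinity>} = B \<and> A \<inter> B = {}"
    if A: "\<And>h. h \<in> A \<Longrightarrow> I h > - \<infinity>" and B: "\<And>h. h \<in> B \<Longrightarrow> I h = - \<infinity>"
    for A B :: "(('j \<Rightarrow> real) \<Rightarrow> real) set" and I :: "_ \<Rightarrow> ereal"
    using A B less_irrefl[of "- \<infinity> :: ereal"] by (blast intro: sym dest: less_imp_neq)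
  show ?thesis
    unfolding finite_metric_functionals_def metric_functionals_at_infinity_def MC
    using separate[of "?ZC \<union> {?O}" "\<lambda>h. INF x\<in>?X. ereal (h x)" ?MU, OF fin inf] by simp
qed

end
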